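(* Let $T\ge 2$ be an integer, with time points $\{0,1,\dots,T\}$, filtration $\{\mathcal F_s\}$ and a flow of preferences $\{J(\cdot;s)\}_{s\in\{0,\dots,T\}}$. For $t\in\{1,\dots,T\}$ let $\tau_*(t)$ denote the sophisticated time for the stopping problem restricted to the time set $\{0,1,\dots,t\}$. Then the sophisticated time is forward monotonic: $\tau_*(t)\le\tau_*(t+1)$ for every $t\in\{1,\dots,T-1\}$.
   Context: Setting. $(\Omega,\mathcal F,\mathbb P)$ is a probability space with filtration $\{\mathcal F_s\}_{s\in\{0,\dots,T\}}$. For every $s$, $J(\cdot;s)$ maps stopping times $\tau\ge s$ (with values in $\{s,\dots,T\}$) to $\mathcal F_s$-measurable real random variables, with $J(\tau_1;s)=J(\tau_2;s)$ if $\tau_1=\tau_2$ a.s. Stopping times that are a.s. equal are identified and inequalities between them are a.s. Problem over $\{0,\dots,t\}$. Only stopping times with values in $\{0,\dots,t\}$ are used, with the same preferences $J(\cdot;s)$, $s\le t$. For such $\rho$, $F(\rho)=\inf\{s<\rho:\ J(s;s)>J(\tau;s)\ \text{for all stopping times }\tau\text{ with }s<\tau\le\rho\}\wedge\rho$, read $\omega$ by $\omega$: a time $s$ with $s<\rho(\omega)$ is in the set iff $J(s;s)(\omega)>J(\tau;s)(\omega)$ for every stopping time $\tau\ge s$ with $\tau\le\rho\vee s$ and $\tau(\omega)>s$; $F(\rho)$ is a stopping time. A stopping time $\tau$ is approachable if $F(\tau)=\tau$. The sophisticated time over $\{0,\dots,t\}$ is the maximal approachable time, i.e. the essential supremum of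 all approachable times with values in $\{0,\dots,t\}$ (it coincides with the essential infimum of the intersection of all admissible sets, where a set $\mathbb B$ of stopping times is admissible if it contains the constant $t$, is closed under $F$, and contains the essential infimum of each of its totally ordered subsets). *)

theory Defs
  imports "HOL-Probability.Probability"
begin

text \<open>
  The filtration is indexed by \<open>nat\<close>, but only the times up to the horizon matter:
  every stopping time below is bounded by the horizon, and a filtration on
  \<open>{0..T}\<close> extends to \<open>nat\<close> by \<open>F s = F T\<close> for \<open>s > T\<close>.
\<close>

definition stopping_times ::
  "'a measure \<Rightarrow> (nat \<Rightarrow> 'a measure) \<Rightarrow> nat \<Rightarrow> nat \<Rightarrow> ('a \<Rightarrow> nat) set" where
  "stopping_times M F s t =
     {\<tau>. stopping_time F \<tau> \<and> (\<forall>\<omega>\<in>space M. s \<le> \<tau> \<omega> \<and> \<tau> \<omega> \<le> t)}"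

text \<open>\<open>J \<tau> s\<close> is the random variable written \<open>J(\<tau>; s)\<close>; its values are
  constrained (and used) only for \<open>\<tau> \<ge> s\<close>.\<close>

definition preference_flow ::
  "'a measure \<Rightarrow> (nat \<Rightarrow> 'a measure) \<Rightarrow> nat \<Rightarrow> (('a \<Rightarrow> nat) \<Rightarrow> nat \<Rightarrow> 'a \<Rightarrow> real) \<Rightarrow> bool" where
  "preference_flow M F T J \<longleftrightarrow>
     (\<forall>s\<le>T. \<forall>\<tau>\<in>stopping_times M F s T. J \<tau> s \<in> borel_measurable (F s)) \<and>
     (\<forall>s\<le>T. \<forall>\<tau>\<^sub>1\<in>stopping_times M F s T. \<forall>\<tau>\<^sub>2\<in>stopping_times M F s T.
        (AE \<omega> in M. \<tau>\<^sub>1 \<omega> = \<tau>\<^sub>2 \<omega>) \<longrightarrow> (AE \<omega> in M. J \<tau>\<^sub>1 s \<omega> = J \<tau>\<^sub>2 s \<omega>))"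

text \<open>
  Essential supremum and infimum of a (possibly uncountable) family of random variables with
  values in a discrete ordered type. With values in \<open>bool\<close>, ordered by implication, the
  essential infimum is the essential intersection of a family of events.
\<close>

definition is_ess_sup :: "'a measure \<Rightarrow> ('a \<Rightarrow> 'b::order) set \<Rightarrow> ('a \<Rightarrow> 'b) \<Rightarrow> bool" where
  "is_ess_sup M \<X> X \<longleftrightarrow>
     X \<in> M \<rightarrow>\<^sub>M count_space UNIV \<and>
     (\<forall>Y\<in>\<X>. AE \<omega> in M. Y \<omega> \<le> X \<omega>) \<and>
     (\<forall>Z\<in>M \<rightarrow>\<^sub>M count_space UNIV.
        (\<forall>Y\<in>\<X>. AE \<omega> in M. Y \<omega> \<le> Z \<omega>) \<longrightarrow> (AE \<omega> in M. X \<omega> \<le> Z \<omega>))"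

definition is_ess_inf :: "'a measure \<Rightarrow> ('a \<Rightarrow> 'b::order) set \<Rightarrow> ('a \<Rightarrow> 'b) \<Rightarrow> bool" where
  "is_ess_inf M \<X> X \<longleftrightarrow>
     X \<in> M \<rightarrow>\<^sub>M count_space UNIV \<and>
     (\<forall>Y\<in>\<X>. AE \<omega> in M. X \<omega> \<le> Y \<omega>) \<and>
     (\<forall>Z\<in>M \<rightarrow>\<^sub>M count_space UNIV.
        (\<forall>Y\<in>\<X>. AE \<omega> in M. Z \<omega> \<le> Y \<omega>) \<longrightarrow> (AE \<omega> in M. Z \<omega> \<le> X \<omega>))"

text \<open>The stopping times \<open>\<tau> \<ge> s\<close> of the problem over \<open>{0..t}\<close> with
  \<open>\<tau> \<le> \<rho> \<or> s\<close> (maximum of \<open>\<rho>\<close> and \<open>s\<close>).\<close>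

definition alternatives ::
  "'a measure \<Rightarrow> (nat \<Rightarrow> 'a measure) \<Rightarrow> nat \<Rightarrow> ('a \<Rightarrow> nat) \<Rightarrow> nat \<Rightarrow> ('a \<Rightarrow> nat) set" where
  "alternatives M F t \<rho> s =
     {\<tau>\<in>stopping_times M F s t. \<forall>\<omega>\<in>space M. \<tau> \<omega> \<le> max (\<rho> \<omega>) s}"

text \<open>The requirement that \<open>\<tau>\<close> imposes at \<open>\<omega>\<close>: if \<open>\<tau>\<close> really continues there, stopping
  at once is strictly better.\<close>

definition stop_better ::
  "(('a \<Rightarrow> nat) \<Rightarrow> nat \<Rightarrow> 'a \<Rightarrow> real) \<Rightarrow> nat \<Rightarrow> ('a \<Rightarrow> nat) \<Rightarrow> 'a \<Rightarrow> bool" where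
  "stop_better J s \<tau> \<omega> \<longleftrightarrow> (s < \<tau> \<omega> \<longrightarrow> J (\<lambda>_. s) s \<omega> > J \<tau> s \<omega>)"

text \<open>
  There are two ways to impose the requirements of all (uncountably many) alternatives.
  \<open>F_pointwise\<close> does so literally, at each sample point.
  \<open>F_essential\<close> does so modulo null sets, through the \<open>F s\<close>-measurable essential
  intersection; up to null sets it depends only on the a.s. equivalence class of \<open>\<rho>\<close> and on
  the a.s. equivalence classes of the values of \<open>J\<close>, and it is a stopping time up to a null
  set. The two agree if the empty set is the only null event, in particular on a finite or countable
  discrete space with positive weights. On atomless spaces they can differ, because at a single
  sample point the literal condition sees modifications of \<open>\<tau>\<close> on a null set.
\<close>

definition F_pointwise ::
  "'a measure \<Rightarrow> (nat \<Rightarrow> 'a measure) \<Rightarrow> (('a \<Rightarrow> nat) \<Rightarrow> nat \<Rightarrow> 'a \<Rightarrow> real) \<Rightarrow>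
   nat \<Rightarrow> ('a \<Rightarrow> nat) \<Rightarrow> 'a \<Rightarrow> nat" where
  "F_pointwise M F J t \<rho> \<omega> =
     Inf (insert (\<rho> \<omega>) {s. s < \<rho> \<omega> \<and> (\<forall>\<tau>\<in>alternatives M F t \<rho> s. stop_better J s \<tau> \<omega>)})"

definition ess_stop_better ::
  "'a measure \<Rightarrow> (nat \<Rightarrow> 'a measure) \<Rightarrow> (('a \<Rightarrow> nat) \<Rightarrow> nat \<Rightarrow> 'a \<Rightarrow> real) \<Rightarrow>
   nat \<Rightarrow> ('a \<Rightarrow> nat) \<Rightarrow> nat \<Rightarrow> 'a \<Rightarrow> bool" where
  "ess_stop_better M F J t \<rho> s =
     (SOME P. Measurable.pred (F s) P \<and>
        is_ess_inf M (stop_better J s ` alternatives M F t \<rho> s) P)"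

definition F_essential ::
  "'a measure \<Rightarrow> (nat \<Rightarrow> 'a measure) \<Rightarrow> (('a \<Rightarrow> nat) \<Rightarrow> nat \<Rightarrow> 'a \<Rightarrow> real) \<Rightarrow>
   nat \<Rightarrow> ('a \<Rightarrow> nat) \<Rightarrow> 'a \<Rightarrow> nat" where
  "F_essential M F J t \<rho> \<omega> =
     Inf (insert (\<rho> \<omega>) {s. s < \<rho> \<omega> \<and> ess_stop_better M F J t \<rho> s \<omega>})"

text \<open>In the following, \<open>\<Phi> t\<close> is the operator (one of the two above) of the problem over
  \<open>{0..t}\<close>.\<close>

definition approachable_times ::
  "'a measure \<Rightarrow> (nat \<Rightarrow> 'a measure) \<Rightarrow> (nat \<Rightarrow> ('a \<Rightarrow> nat) \<Rightarrow> 'a \<Rightarrow> nat) \<Rightarrow>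
   nat \<Rightarrow> ('a \<Rightarrow> nat) set" where
  "approachable_times M F \<Phi> t =
     {\<tau>\<in>stopping_times M F 0 t. AE \<omega> in M. \<Phi> t \<tau> \<omega> = \<tau> \<omega>}"

text \<open>The choice is between versions that are a.s. equal.\<close>

definition sophisticated_time ::
  "'a measure \<Rightarrow> (nat \<Rightarrow> 'a measure) \<Rightarrow> (nat \<Rightarrow> ('a \<Rightarrow> nat) \<Rightarrow> 'a \<Rightarrow> nat) \<Rightarrow>
   nat \<Rightarrow> 'a \<Rightarrow> nat" where
  "sophisticated_time M F \<Phi> t =
     (SOME \<tau>. \<tau> \<in> stopping_times M F 0 t \<and> is_ess_sup M (approachable_times M F \<Phi> t) \<tau>)"

end

theory Submission
  imports Defs
begin

text \<open>
  The monotonicity has a simple reason: an approachable time \<open>\<rho>\<close> of the problem over \<open>{0..t}\<close> is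
  also approachable over \<open>{0..t + 1}\<close>. Whether an agent at time \<open>s < \<rho>\<close> wants to stop is decided by
  comparing \<open>s\<close> with stopping times that do not exceed \<open>\<rho> \<or> s\<close>, and such times never use the additional
  date \<open>t + 1\<close>. So the two operators agree at \<open>\<rho>\<close> (lemma \<open>alternatives_horizon_cong\<close>) and the
  approachable families are nested; the essential supremum of the larger family dominates every
  member of the smaller one, hence also its essential supremum.

  What has to be supplied is that the sophisticated times exist, that is, that a family of
  stopping times bounded by \<open>t\<close> has an essential supremum that is again a stopping time. Lemma
  \<open>ess_sup_countable_exists\<close> obtains it as the pointwise supremum of a sequence from the family,
  and a countable supremum of stopping times is a stopping time.
\<close>

section \<open>Essential suprema of bounded families\<close>

text \<open>Measurability with respect to \<open>M\<close> is available only up to the horizon \<open>t\<close>; beyond it the bound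
  on \<open>\<tau>\<close> makes the event \<open>\<tau> \<le> k\<close> certain.\<close>

lemma stopping_times_measurable:
  assumes \<tau>: "\<tau> \<in> stopping_times M F s t" and sub: "\<And>s. s \<le> t \<Longrightarrow> subalgebra M (F s)"
  shows "\<tau> \<in> M \<rightarrow>\<^sub>M count_space UNIV"
proof -
  have le: "Measurable.pred M (\<lambda>\<omega>. \<tau> \<omega> \<le> k)" for k
  proof (cases "k \<le> t")
    case True
    have "Measurable.pred (F k) (\<lambda>\<omega>. \<tau> \<omega> \<le> k)"
      using \<tau> by (auto simp: stopping_times_def stopping_time_def)
    then show ?thesis
      using measurable_from_subalg[OF sub[OF True]] by blast
  next
    case False
    then have "\<And>\<omega>. \<omega> \<in> space M \<Longrightarrow> (\<tau> \<omega> \<le> k) = True"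
      using \<tau> by (force simp: stopping_times_def)
    then show ?thesis
      by (subst measurable_cong[where g = "\<lambda>_. True"]) auto
  qed
  have "\<tau> \<in> borel_measurable M"
    by (rule borel_measurableI_le) (use le in \<open>simp add: pred_def\<close>)
  then show ?thesis
    by (simp add: measurable_cong_sets[OF refl sets_borel_eq_count_space])
qed

text \<open>Exhaustion: among all sequences from the family, one maximises the expectation of its pointwise
  supremum, because the sequences that approach the maximal value can be merged into one. Adding a
  further member \<open>Y\<close> to it does not increase the expectation, hence \<open>Y\<close> lies below the supremum
  almost everywhere.\<close>

lemma ess_sup_countable_exists:
  fixes \<X> :: "('a \<Rightarrow> nat) set"
  assumes "finite_measure M" and "\<X> \<noteq> {}"
    and meas: "\<And>Y. Y \<in> \<X> \<Longrightarrow> Y \<in> M \<rightarrow>\<^sub>M count_space UNIV"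
    and bound: "\<And>Y \<omega>. Y \<in> \<X> \<Longrightarrow> \<omega> \<in> space M \<Longrightarrow> Y \<omega> \<le> t"
  shows "\<exists>f :: nat \<Rightarrow> 'a \<Rightarrow> nat. range f \<subseteq> \<X> \<and> is_ess_sup M \<X> (\<lambda>\<omega>. SUP n. f n \<omega>)"
proof -
  interpret finite_measure M by fact
  define S where "S f \<omega> = (SUP n. f n \<omega>)" for f :: "nat \<Rightarrow> 'a \<Rightarrow> nat" and \<omega>
  define I where "I f = (\<integral>\<omega>. real (S f \<omega>) \<partial>M)" for f
  define Seq where "Seq = {f :: nat \<Rightarrow> 'a \<Rightarrow> nat. range f \<subseteq> \<X>}"
  have upper: "f n \<omega> \<le> S f \<omega>" if "f \<in> Seq" "\<omega> \<in> space M" for f n \<omega>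
    unfolding S_def using that bound
    by (intro cSUP_upper bdd_aboveI[where M = t]) (auto simp: Seq_def)
  have least: "S f \<omega> \<le> k" if "\<And>n. f n \<omega> \<le> k" for f \<omega> k
    unfolding S_def using that by (intro cSUP_least) auto
  have S_bound: "S f \<omega> \<le> t" if "f \<in> Seq" "\<omega> \<in> space M" for f \<omega>
    using that bound by (intro least) (auto simp: Seq_def)
  have S_meas [measurable]: "S f \<in> M \<rightarrow>\<^sub>M count_space UNIV" if "f \<in> Seq" for f
  proof -
    have [measurable]: "f n \<in> M \<rightarrow>\<^sub>M count_space UNIV" for n
      using that meas by (auto simp: Seq_def)
    have "Measurable.pred M (\<lambda>\<omega>. i \<in> range (\<lambda>n. f n \<omega>))" for i
      unfolding image_iff by measurable
    then show ?thesis
      unfolding S_def[abs_def] by (rule measurable_Sup_nat)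
  qed
  have int: "integrable M (\<lambda>\<omega>. real (S f \<omega>))" if "f \<in> Seq" for f
    using that S_meas[OF that] S_bound[OF that]
    by (intro integrable_const_bound[where B = "real t"]) auto
  have I_mono: "I f \<le> I g" if "f \<in> Seq" "g \<in> Seq" "\<And>\<omega>. \<omega> \<in> space M \<Longrightarrow> S f \<omega> \<le> S g \<omega>" for f g
    unfolding I_def using that by (intro integral_mono int) auto
  have I_bdd: "bdd_above (I ` Seq)"
  proof (rule bdd_aboveI2)
    fix f assume "f \<in> Seq"
    then have "I f \<le> (\<integral>\<omega>. real t \<partial>M)"
      unfolding I_def using S_bound by (intro integral_mono int) auto
    then show "I f \<le> (\<integral>\<omega>. real t \<partial>M)" .
  qed
  obtain Y0 where "Y0 \<in> \<X>"
    using \<open>\<X> \<noteq> {}\<close> by auto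
  then have "(\<lambda>_. Y0) \<in> Seq"
    by (auto simp: Seq_def)
  define m where "m = (SUP f\<in>Seq. I f)"
  have "\<exists>f\<in>Seq. m - 1 / real (Suc k) < I f" for k
    using \<open>(\<lambda>_. Y0) \<in> Seq\<close> unfolding m_def
    by (subst less_cSUP_iff[OF _ I_bdd, symmetric]) auto
  then obtain f where f: "\<And>k. f k \<in> Seq" "\<And>k. m - 1 / real (Suc k) < I (f k)"
    by metis
  define g where "g n = f (fst (prod_decode n)) (snd (prod_decode n))" for n
  have g: "g \<in> Seq"
    using f(1) by (auto simp: Seq_def g_def)
  have "I (f k) \<le> I g" for k
  proof (rule I_mono[OF f(1) g])
    fix \<omega> assume "\<omega> \<in> space M"
    then show "S (f k) \<omega> \<le> S g \<omega>"
      using upper[OF g, of \<omega> "prod_encode (k, n)" for n] by (intro least) (auto simp: g_def)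
  qed
  then have near: "m - 1 / real (Suc k) < I g" for k
    using f(2)[of k] by (meson less_le_trans)
  have "m \<le> I g"
  proof (rule ccontr)
    assume "\<not> m \<le> I g"
    then obtain k where "inverse (real (Suc k)) < m - I g"
      using reals_Archimedean[of "m - I g"] by auto
    with near[of k] show False
      by (simp add: inverse_eq_divide)
  qed
  have dominated: "AE \<omega> in M. Y \<omega> \<le> S g \<omega>" if Y: "Y \<in> \<X>" for Y
  proof -
    define h where "h = case_nat Y g"
    have h: "h \<in> Seq"
      using g Y by (auto simp: Seq_def h_def range_subsetD split: nat.splits)
    have le: "S g \<omega> \<le> S h \<omega>" if "\<omega> \<in> space M" for \<omega>
      using upper[OF h that, of "Suc n" for n] by (intro least) (auto simp: h_def)
    have "I h \<le> m"
      unfolding m_def using h I_bdd by (rule cSUP_upper)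
    with \<open>m \<le> I g\<close> I_mono[OF g h le] have "I h = I g"
      by auto
    then have "(\<integral>\<omega>. real (S h \<omega>) - real (S g \<omega>) \<partial>M) = 0"
      using int[OF g] int[OF h] by (simp add: I_def)
    then have "AE \<omega> in M. real (S h \<omega>) - real (S g \<omega>) = 0"
      using int[OF g] int[OF h] le
      by (subst (asm) integral_nonneg_eq_0_iff_AE) auto
    then show ?thesis
      using AE_space
    proof eventually_elim
      case (elim \<omega>)
      then show ?case
        using upper[OF h, of \<omega> 0] by (auto simp: h_def)
    qed
  qed
  have "AE \<omega> in M. S g \<omega> \<le> Z \<omega>" if "\<forall>Y\<in>\<X>. AE \<omega> in M. Y \<omega> \<le> Z \<omega>" for Z
  proof -
    have "AE \<omega> in M. \<forall>n. g n \<omega> \<le> Z \<omega>"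
      using that g by (subst AE_all_countable) (auto simp: Seq_def)
    then show ?thesis
      by eventually_elim (auto intro: least)
  qed
  then have "is_ess_sup M \<X> (S g)"
    using S_meas[OF g] dominated by (auto simp: is_ess_sup_def)
  then show ?thesis
    using g by (auto simp: Seq_def S_def[abs_def])
qed

lemma stopping_times_SUP:
  assumes f: "\<And>n :: nat. f n \<in> stopping_times M F s t"
    and space: "\<And>k. space (F k) = space M"
  shows "(\<lambda>\<omega>. SUP n. f n \<omega>) \<in> stopping_times M F s t"
proof -
  have bdd: "bdd_above (range (\<lambda>n. f n \<omega>))" if "\<omega> \<in> space M" for \<omega>
    using f that by (intro bdd_aboveI[where M = t]) (auto simp: stopping_times_def)
  have "Measurable.pred (F k) (\<lambda>\<omega>. (SUP n. f n \<omega>) \<le> k)" for k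
  proof -
    have [measurable]: "Measurable.pred (F k) (\<lambda>\<omega>. f n \<omega> \<le> k)" for n
      using f[of n] by (auto simp: stopping_times_def stopping_time_def)
    have "(\<forall>n. f n \<omega> \<le> k) = ((SUP n. f n \<omega>) \<le> k)" if "\<omega> \<in> space (F k)" for \<omega>
      using that bdd by (subst cSUP_le_iff) (auto simp: space)
    moreover have "Measurable.pred (F k) (\<lambda>\<omega>. \<forall>n. f n \<omega> \<le> k)"
      by measurable
    ultimately show ?thesis
      by (rule measurable_cong[THEN iffD1])
  qed
  moreover have "s \<le> (SUP n. f n \<omega>)" if "\<omega> \<in> space M" for \<omega>
  proof -
    have "s \<le> f 0 \<omega>"
      using f[of 0] that by (simp add: stopping_times_def)
    also have "\<dots> \<le> (SUP n. f n \<omega>)"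
      by (rule cSUP_upper[OF UNIV_I bdd[OF that]])
    finally show ?thesis .
  qed
  moreover have "(SUP n. f n \<omega>) \<le> t" if "\<omega> \<in> space M" for \<omega>
    using f that by (intro cSUP_least) (auto simp: stopping_times_def)
  ultimately show ?thesis
    by (simp add: stopping_times_def stopping_time_def)
qed

section \<open>Existence of sophisticated times\<close>

text \<open>The constant \<open>0\<close> is approachable for every operator that never increases a time, so the family
  whose essential supremum is taken is not empty and is exhausted by a sequence of stopping times.
  Some stopping time therefore meets the two requirements of the choice, and so does the chosen one.\<close>

lemma sophisticated_time_is_ess_sup:
  assumes "prob_space M" and fil: "filtration (space M) F"
    and sub: "\<And>s. s \<le> t \<Longrightarrow> subalgebra M (F s)"
    and decr: "\<And>\<rho> \<omega>. \<Phi> t \<rho> \<omega> \<le> \<rho> \<omega>"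
  shows "sophisticated_time M F \<Phi> t \<in> stopping_times M F 0 t"
    and "is_ess_sup M (approachable_times M F \<Phi> t) (sophisticated_time M F \<Phi> t)"
proof -
  interpret prob_space M by fact
  let ?A = "approachable_times M F \<Phi> t"
  have A_stop: "?A \<subseteq> stopping_times M F 0 t"
    by (auto simp: approachable_times_def)
  have space: "space (F k) = space M" for k
    using fil by (rule filtration.space_F)
  have "\<Phi> t (\<lambda>_. 0) \<omega> = 0" for \<omega>
    using decr[of "\<lambda>_. 0" \<omega>] by simp
  then have "(\<lambda>_. 0) \<in> ?A"
    by (auto simp: approachable_times_def stopping_times_def stopping_time_def)
  then have "?A \<noteq> {}"
    by auto
  then obtain f :: "nat \<Rightarrow> 'a \<Rightarrow> nat"
    where f: "range f \<subseteq> ?A" "is_ess_sup M ?A (\<lambda>\<omega>. SUP n. f n \<omega>)"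
    using ess_sup_countable_exists[OF finite_measure_axioms, of ?A t] A_stop sub
      stopping_times_measurable[of _ M F 0 t]
    by (auto simp: stopping_times_def subset_eq)
  have "(\<lambda>\<omega>. SUP n. f n \<omega>) \<in> stopping_times M F 0 t"
    using f(1) A_stop space by (intro stopping_times_SUP) auto
  with f(2) have "\<exists>\<tau>. \<tau> \<in> stopping_times M F 0 t \<and> is_ess_sup M ?A \<tau>"
    by blast
  from someI_ex[OF this]
  show "sophisticated_time M F \<Phi> t \<in> stopping_times M F 0 t"
    and "is_ess_sup M ?A (sophisticated_time M F \<Phi> t)"
    by (simp_all add: sophisticated_time_def)
qed

lemma is_ess_sup_mono:
  assumes "is_ess_sup M \<X> X" and "is_ess_sup M \<Y> Y" and "\<X> \<subseteq> \<Y>"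
  shows "AE \<omega> in M. X \<omega> \<le> Y \<omega>"
  using assms unfolding is_ess_sup_def by blast

section \<open>Monotonicity in the horizon\<close>

text \<open>An alternative at \<open>s \<le> t\<close> is bounded by \<open>\<rho> \<or> s\<close>, hence already by the shorter horizon.\<close>

lemma alternatives_horizon_cong:
  assumes "\<rho> \<in> stopping_times M F 0 t" and "s \<le> t" and "t \<le> u"
  shows "alternatives M F u \<rho> s = alternatives M F t \<rho> s"
  using assms by (fastforce simp: alternatives_def stopping_times_def)

lemma approachable_times_mono:
  assumes "t \<le> u"
    and "\<And>\<rho> \<omega>. \<rho> \<in> stopping_times M F 0 t \<Longrightarrow> \<omega> \<in> space M \<Longrightarrow> \<Phi> u \<rho> \<omega> = \<Phi> t \<rho> \<omega>"
  shows "approachable_times M F \<Phi> t \<subseteq> approachable_times M F \<Phi> u"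
proof
  fix \<rho> assume "\<rho> \<in> approachable_times M F \<Phi> t"
  then have \<rho>: "\<rho> \<in> stopping_times M F 0 t" and fixed: "AE \<omega> in M. \<Phi> t \<rho> \<omega> = \<rho> \<omega>"
    by (auto simp: approachable_times_def)
  have "AE \<omega> in M. \<Phi> u \<rho> \<omega> = \<rho> \<omega>"
    using fixed AE_space by eventually_elim (simp add: assms(2)[OF \<rho>])
  moreover have "\<rho> \<in> stopping_times M F 0 u"
    using \<rho> \<open>t \<le> u\<close> by (force simp: stopping_times_def)
  ultimately show "\<rho> \<in> approachable_times M F \<Phi> u"
    by (simp add: approachable_times_def)
qed

lemma sophisticated_time_mono:
  assumes "prob_space M" and "filtration (space M) F"
    and "\<And>s. s \<le> u \<Longrightarrow> subalgebra M (F s)" and "t \<le> u"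
    and "\<And>t \<rho> \<omega>. \<Phi> t \<rho> \<omega> \<le> \<rho> \<omega>"
    and "\<And>\<rho> \<omega>. \<rho> \<in> stopping_times M F 0 t \<Longrightarrow> \<omega> \<in> space M \<Longrightarrow> \<Phi> u \<rho> \<omega> = \<Phi> t \<rho> \<omega>"
  shows "AE \<omega> in M. sophisticated_time M F \<Phi> t \<omega> \<le> sophisticated_time M F \<Phi> u \<omega>"
proof (rule is_ess_sup_mono)
  show "is_ess_sup M (approachable_times M F \<Phi> t) (sophisticated_time M F \<Phi> t)"
    using assms(3,4) by (intro sophisticated_time_is_ess_sup(2) assms(1,2,5)) auto
  show "is_ess_sup M (approachable_times M F \<Phi> u) (sophisticated_time M F \<Phi> u)"
    by (intro sophisticated_time_is_ess_sup(2) assms(1,2,3,5))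
  show "approachable_times M F \<Phi> t \<subseteq> approachable_times M F \<Phi> u"
    using assms(4,6) by (rule approachable_times_mono)
qed

text \<open>Only dates \<open>s < \<rho> \<omega> \<le> t\<close> enter the operators, so they see the horizon only through the
  alternatives at such dates.\<close>

lemma F_pointwise_horizon_cong:
  assumes \<rho>: "\<rho> \<in> stopping_times M F 0 t" and "\<omega> \<in> space M" and "t \<le> u"
  shows "F_pointwise M F J u \<rho> \<omega> = F_pointwise M F J t \<rho> \<omega>"
proof -
  have "\<rho> \<omega> \<le> t"
    using \<rho> \<open>\<omega> \<in> space M\<close> by (auto simp: stopping_times_def)
  then have "alternatives M F u \<rho> s = alternatives M F t \<rho> s" if "s < \<rho> \<omega>" for s
    using that \<open>t \<le> u\<close> by (intro alternatives_horizon_cong[OF \<rho>]) auto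
  then show ?thesis
    by (simp add: F_pointwise_def cong: conj_cong)
qed

text \<open>The event that the essential version chooses at \<open>s\<close> is literally the same for both horizons,
  because it is chosen by a condition on the same family.\<close>

lemma F_essential_horizon_cong:
  assumes \<rho>: "\<rho> \<in> stopping_times M F 0 t" and "\<omega> \<in> space M" and "t \<le> u"
  shows "F_essential M F J u \<rho> \<omega> = F_essential M F J t \<rho> \<omega>"
proof -
  have "\<rho> \<omega> \<le> t"
    using \<rho> \<open>\<omega> \<in> space M\<close> by (auto simp: stopping_times_def)
  then have "alternatives M F u \<rho> s = alternatives M F t \<rho> s" if "s < \<rho> \<omega>" for s
    using that \<open>t \<le> u\<close> by (intro alternatives_horizon_cong[OF \<rho>]) auto
  then show ?thesis
    by (simp add: F_essential_def ess_stop_better_def cong: conj_cong)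
qed

theorem theorem5p2:
  fixes M :: "'a measure" and F :: "nat \<Rightarrow> 'a measure" and T :: nat
    and J :: "('a \<Rightarrow> nat) \<Rightarrow> nat \<Rightarrow> 'a \<Rightarrow> real"
  assumes "prob_space M"
    and "filtration (space M) F"
    and "\<And>s. s \<le> T \<Longrightarrow> subalgebra M (F s)"
    and "preference_flow M F T J"
    and "T \<ge> 2"
  shows "\<forall>t\<in>{1..T - 1}.
    (AE \<omega> in M. sophisticated_time M F (F_pointwise M F J) t \<omega>
                 \<le> sophisticated_time M F (F_pointwise M F J) (t + 1) \<omega>) \<and>
    (AE \<omega> in M. sophisticated_time M F (F_essential M F J) t \<omega>
                 \<le> sophisticated_time M F (F_essential M F J) (t + 1) \<omega>)"
proof (intro ballI conjI)
  fix t assume t: "t \<in> {1..T - 1}"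
  then have sub: "\<And>s. s \<le> t + 1 \<Longrightarrow> subalgebra M (F s)"
    using assms(3,5) by auto
  have decr: "F_pointwise M F J t \<rho> \<omega> \<le> \<rho> \<omega>" "F_essential M F J t \<rho> \<omega> \<le> \<rho> \<omega>" for t \<rho> \<omega>
    unfolding F_pointwise_def F_essential_def by (auto intro: cInf_lower)
  note mono = sophisticated_time_mono[OF assms(1,2) sub le_add1[of t 1]]
  show "AE \<omega> in M. sophisticated_time M F (F_pointwise M F J) t \<omega>
                 \<le> sophisticated_time M F (F_pointwise M F J) (t + 1) \<omega>"
    by (intro mono decr F_pointwise_horizon_cong) auto
  show "AE \<omega> in M. sophisticated_time M F (F_essential M F J) t \<omega>
                 \<le> sophisticated_time M F (F_essential M F J) (t + 1) \<omega>"
    by (intro mono decr F_essential_horizon_cong) auto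
qed

end
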